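(* Let $E$ be a Polish space with Borel $\sigma$-algebra $\mathscr{E}$, let $\psi:E\to[1,\infty)$ be continuous, and let $\mathbb{P}$ be a probability measure on $\Omega=E^{\mathbb{N}}$, with coordinate projections $\xi=(\xi_1,\xi_2,\dots)$, empirical measures $m_n=\frac1n\sum_{i=1}^n\delta_{\xi_i}$, and canonical random measure $\upsilon$ (a regular version of the conditional distribution $\mathbb{P}[\xi_1\in\cdot\,\vert\,\mathscr{I}]$ given the shift-invariant $\sigma$-algebra $\mathscr{I}$). If $\xi$ is stationary and the law $\mathscr{L}(\xi_1)$ of $\xi_1$ belongs to $\mathfrak{M}_1^\psi(E)$, i.e. $\int_\Omega\psi(\xi_1)\,d\mathbb{P}<+\infty$, then $\mathbb{P}$-almost surely $m_n\to\upsilon$ in the $\psi$-weak topology as $n\to+\infty$.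
   Context: $\mathfrak{M}_1(E)$ is the set of Borel probability measures on $E$, and $\mu f:=\int_E f\,d\mu$. For the continuous gauge function $\psi\ge 1$: $\mathfrak{M}_1^\psi(E):=\{\mu\in\mathfrak{M}_1(E):\mu\psi<+\infty\}$ and $\mathfrak{C}_\psi(E):=\{f:E\to\mathbb{R}\text{ continuous}:\ \|f/\psi\|_\infty<\infty\}$. The $\psi$-weak topology is the coarsest topology on $\mathfrak{M}_1^\psi(E)$ making all maps $\mu\mapsto\mu f$, $f\in\mathfrak{C}_\psi(E)$, continuous. $\Omega=E^{\mathbb{N}}$, $\xi_n(\omega)=\omega_n$ for $\omega=(\omega_1,\omega_2,\dots)$, $\mathscr{F}$ is the product $\sigma$-algebra $\mathscr{E}^{\mathbb{N}}$ generated by the $\xi_n$, and $(\Omega,\mathscr{F},\mathbb{P})$ is taken to be complete (i.e. completed with respect to $\mathbb{P}$). $\Sigma(x_1,x_2,\dots)=(x_2,x_3,\dots)$ is the shift on $E^{\mathbb{N}}$. $\xi$ is stationary if $\xi$ and $\Sigma\xi$ have the same law on $(E^{\mathbb{N}},\mathscr{E}^{\mathbb{N}})$. The shift-invariant $\sigma$-algebra is $\mathscr{I}=\{I\in\mathscr{E}^{\mathbb{N}}:\Sigma^{-1}(I)=I\}$. The canonical random measure $\upsilon$ is an ($\mathbb{P}$-essentially unique) $\mathscr{I}$-measurable probability kernel $(\omega,B)\mapsto\upsilon(\omega,B)$, $\omega\in\Omega$, $B\in\mathscr{E}$, that is a regular version of $\mathbb{P}[\xi_1\in\cdot\,\vert\,\mathscr{I}]$.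 When $\mathscr{L}(\xi_1)\in\mathfrak{M}_1^\psi(E)$, one has $\upsilon\in\mathfrak{M}_1^\psi(E)$ $\mathbb{P}$-almost surely. *)

theory Defs
  imports "HOL-Probability.Probability"
begin

text \<open>
  Sequences are indexed from 0: the coordinate \<open>\<omega> i\<close> of a path \<open>\<omega>\<close> plays the role of \<open>\<xi>\<close> with index
  \<open>i + 1\<close>; in particular \<open>\<omega> 0\<close> is the first coordinate.
\<close>

abbreviation path_space :: "(nat \<Rightarrow> 'a::topological_space) measure" where
  "path_space \<equiv> Pi\<^sub>M UNIV (\<lambda>_. borel)"

definition path_shift :: "(nat \<Rightarrow> 'a) \<Rightarrow> (nat \<Rightarrow> 'a)" where
  "path_shift \<omega> = (\<lambda>i. \<omega> (Suc i))"

definition stationary :: "(nat \<Rightarrow> 'a::topological_space) measure \<Rightarrow> bool" where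
  "stationary P \<longleftrightarrow> distr P path_space (\<lambda>\<omega>. \<omega>) = distr P path_space (\<lambda>\<omega>. path_shift \<omega>)"

definition invariant_algebra :: "(nat \<Rightarrow> 'a::topological_space) measure" where
  "invariant_algebra = sigma UNIV {I \<in> sets path_space. path_shift -` I = I}"

definition empirical_measure :: "nat \<Rightarrow> (nat \<Rightarrow> 'a::topological_space) \<Rightarrow> 'a measure" where
  "empirical_measure n \<omega> =
     measure_of UNIV (sets borel) (\<lambda>A. (\<Sum>i<n. emeasure (return borel (\<omega> i)) A) / of_nat n)"

text \<open>
  Measurability into \<open>prob_algebra borel\<close> says that \<open>\<upsilon>\<close> is a probability kernel for which
  \<open>\<upsilon> \<omega> B\<close> is measurable in \<open>\<omega>\<close>, with respect to the uncompleted invariant \<open>\<sigma>\<close>-algebra.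
\<close>

definition canonical_random_measure ::
    "(nat \<Rightarrow> 'a::topological_space) measure \<Rightarrow> ((nat \<Rightarrow> 'a) \<Rightarrow> 'a measure) \<Rightarrow> bool" where
  "canonical_random_measure P \<upsilon> \<longleftrightarrow>
     \<upsilon> \<in> invariant_algebra \<rightarrow>\<^sub>M prob_algebra borel \<and>
     (\<forall>B\<in>sets borel. AE \<omega> in P.
        measure (\<upsilon> \<omega>) B = real_cond_exp P invariant_algebra (indicator {\<omega>. \<omega> 0 \<in> B}) \<omega>)"

definition psi_measures :: "('a::topological_space \<Rightarrow> real) \<Rightarrow> 'a measure set" where
  "psi_measures \<psi> =
     {\<mu>. prob_space \<mu> \<and> sets \<mu> = sets borel \<and> (\<integral>\<^sup>+x. ennreal (\<psi> x) \<partial>\<mu>) < \<infinity>}"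

definition psi_functions :: "('a::topological_space \<Rightarrow> real) \<Rightarrow> ('a \<Rightarrow> real) set" where
  "psi_functions \<psi> = {f. continuous_on UNIV f \<and> bounded (range (\<lambda>x. f x / \<psi> x))}"

definition psi_weak_topology :: "('a::topological_space \<Rightarrow> real) \<Rightarrow> 'a measure topology" where
  "psi_weak_topology \<psi> = topology_generated_by
     {{\<mu> \<in> psi_measures \<psi>. (\<integral>x. f x \<partial>\<mu>) \<in> U} | f U. f \<in> psi_functions \<psi> \<and> open U}"

lemma sets_invariant_algebra:
  "sets invariant_algebra = {I \<in> sets path_space. path_shift -` I = (I :: (nat \<Rightarrow> 'a::topological_space) set)}"
proof -
  have "sigma_algebra UNIV {I \<in> sets path_space. path_shift -` I = (I :: (nat \<Rightarrow> 'a) set)}"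
    unfolding sigma_algebra_iff2
  proof (intro conjI ballI allI impI)
    fix s assume "s \<in> {I \<in> sets path_space. path_shift -` I = (I :: (nat \<Rightarrow> 'a) set)}"
    then have "s \<in> sets path_space" "path_shift -` s = s"
      by auto
    moreover from this(1) have "space path_space - s \<in> sets path_space"
      by (rule sets.compl_sets)
    ultimately show "UNIV - s \<in> {I \<in> sets path_space. path_shift -` I = I}"
      by (simp add: space_PiM vimage_Diff)
  next
    fix A :: "nat \<Rightarrow> (nat \<Rightarrow> 'a) set"
    assume "range A \<subseteq> {I \<in> sets path_space. path_shift -` I = I}"
    then show "(\<Union>i. A i) \<in> {I \<in> sets path_space. path_shift -` I = I}"
      by (auto simp: vimage_UN)
  qed auto
  then show ?thesis
    unfolding invariant_algebra_def by (simp add: sigma_algebra.sigma_sets_eq)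
qed

lemma emeasure_empirical_measure:
  assumes "A \<in> sets borel"
  shows "emeasure (empirical_measure n \<omega>) A = (\<Sum>i<n. indicator A (\<omega> i)) / of_nat n"
proof -
  have "countably_additive (sets borel)
          (\<lambda>A. (\<Sum>i<n. emeasure (return borel (\<omega> i)) A) / of_nat n)"
  proof (rule countably_additiveI)
    fix A :: "nat \<Rightarrow> 'a set"
    assume A: "range A \<subseteq> sets borel" "disjoint_family A"
    have "(\<Sum>k. (\<Sum>i<n. emeasure (return borel (\<omega> i)) (A k)) / of_nat n)
        = (\<Sum>k. \<Sum>i<n. emeasure (return borel (\<omega> i)) (A k)) / of_nat n"
      by (simp add: divide_ennreal_def)
    also have "(\<Sum>k. \<Sum>i<n. emeasure (return borel (\<omega> i)) (A k))
        = (\<Sum>i<n. \<Sum>k. emeasure (return borel (\<omega> i)) (A k))"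
      by (rule suminf_sum) auto
    also have "\<dots> = (\<Sum>i<n. emeasure (return borel (\<omega> i)) (\<Union>k. A k))"
      using A by (intro sum.cong suminf_emeasure) auto
    finally show "(\<Sum>k. (\<Sum>i<n. emeasure (return borel (\<omega> i)) (A k)) / of_nat n)
        = (\<Sum>i<n. emeasure (return borel (\<omega> i)) (\<Union>k. A k)) / of_nat n" .
  qed
  moreover have "positive (sets borel)
          (\<lambda>A. (\<Sum>i<n. emeasure (return borel (\<omega> i)) A) / of_nat n)"
    by (simp add: positive_def)
  ultimately have "emeasure (empirical_measure n \<omega>) A
      = (\<Sum>i<n. emeasure (return borel (\<omega> i)) A) / of_nat n"
    unfolding empirical_measure_def
    using assms sets.sigma_algebra_axioms[of "borel :: 'a measure"]
    by (intro emeasure_measure_of_sigma) simp_all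
  then show ?thesis
    using assms by simp
qed

lemma topspace_psi_weak_topology: "topspace (psi_weak_topology \<psi>) = psi_measures \<psi>"
proof -
  have "(\<lambda>_. 0) \<in> psi_functions \<psi>"
    by (simp add: psi_functions_def)
  moreover have "psi_measures \<psi> = {\<mu> \<in> psi_measures \<psi>. (\<integral>x. (\<lambda>_. 0::real) x \<partial>\<mu>) \<in> UNIV}"
    by simp
  ultimately show ?thesis
    unfolding psi_weak_topology_def topology_generated_by_topspace by blast
qed

end

theory Submission
  imports Defs
begin

text \<open>
  \<^bold>\<open>Birkhoff's theorem.\<close> Let \<open>F\<^sub>n\<close> be the running maximum of the sums of \<open>g\<close> along the orbit and let \<open>D\<close>
  be the invariant set where \<open>F\<^sub>n\<close> is unbounded. Since \<open>F\<^sub>n\<^sub>+\<^sub>1 - F\<^sub>n \<circ> T = g - min 0 (F\<^sub>n \<circ> T)\<close>, which tends to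
  \<open>g\<close> on \<open>D\<close>, and \<open>F\<^sub>n \<le> F\<^sub>n\<^sub>+\<^sub>1\<close>, invariance and dominated convergence give \<open>0 \<le> \<integral>\<^sub>D g\<close>. For \<open>g\<close> equal to \<open>f\<close>
  minus its conditional expectation minus \<open>\<epsilon>\<close> this forces \<open>D\<close> to be null, which bounds the averages
  of \<open>f\<close> from above; apply this to \<open>f\<close> and \<open>-f\<close>.

  \<^bold>\<open>A countable family of test functions.\<close> Birkhoff's theorem is applied to \<open>\<psi>\<close> and to the countably many
  maxima of finitely many functions \<open>q \<cdot> 1\<^sub>U\<close>, with \<open>q\<close> rational and \<open>U\<close> in a countable base. Every
  continuous \<open>h \<ge> 0\<close> is the limit from below of such maxima, so the \<open>liminf\<close> of its empirical averages is
  almost surely at least its \<open>\<upsilon>\<close>-integral, with one null set for all \<open>h\<close>. For \<open>\<bar>f\<bar> \<le> C \<cdot> \<psi>\<close>, taking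
  \<open>h = C \<cdot> \<psi> \<plusminus> f\<close> and using convergence for \<open>\<psi>\<close> gives convergence for \<open>f\<close>. No tightness is needed.
\<close>

subsection \<open>The pointwise ergodic theorem\<close>

text \<open>
  \<open>max_birkhoff_sum T g n x\<close> is the maximum of the sums \<open>\<Sum>i<k. g ((T ^^ i) x)\<close> over \<open>1 \<le> k \<le> n + 1\<close>.
\<close>
primrec max_birkhoff_sum :: "('a \<Rightarrow> 'a) \<Rightarrow> ('a \<Rightarrow> real) \<Rightarrow> nat \<Rightarrow> 'a \<Rightarrow> real" where
  "max_birkhoff_sum T g 0 = g"
| "max_birkhoff_sum T g (Suc n) = (\<lambda>x. g x + max 0 (max_birkhoff_sum T g n (T x)))"

lemma birkhoff_sum_le_max_birkhoff_sum:
  "(\<Sum>i<Suc n. g ((T ^^ i) x)) \<le> max_birkhoff_sum T g n x"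
proof (induction n arbitrary: x)
  case (Suc n)
  \<comment> \<open>Splitting off the summand at \<open>i = 0\<close> leaves an orbit sum started at
    \<open>T x\<close>, which matches the recursion of \<open>max_birkhoff_sum\<close>.\<close>
  have "(\<Sum>i<Suc (Suc n). g ((T ^^ i) x)) = g x + (\<Sum>i<Suc n. g ((T ^^ i) (T x)))"
    by (subst sum.lessThan_Suc_shift) (simp add: funpow_swap1)
  also have "\<dots> \<le> max_birkhoff_sum T g (Suc n) x"
    using Suc.IH[of "T x"] by simp
  finally show ?case .
qed simp

lemma max_birkhoff_sum_Suc_ge: "max_birkhoff_sum T g n x \<le> max_birkhoff_sum T g (Suc n) x"
proof (induction n arbitrary: x)
  case (Suc n)
  show ?case
    using Suc.IH[of "T x"] unfolding max_birkhoff_sum.simps(2)[of T g "Suc n"] max_birkhoff_sum.simps(2)[of T g n]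
    by (intro add_left_mono max.mono order_refl) simp
qed simp

lemma max_birkhoff_sum_mono: "m \<le> n \<Longrightarrow> max_birkhoff_sum T g m x \<le> max_birkhoff_sum T g n x"
  by (rule lift_Suc_mono_le) (rule max_birkhoff_sum_Suc_ge)

section \<open>Measure-preserving systems and their strictly invariant sets\<close>

text \<open>\<open>J\<close> is a measure only because conditional expectations take their
  sub-\<sigma>-algebra in that form; just its space and its sets are constrained. Invariance is
  strict, not modulo null sets.\<close>

locale measure_preserving_system = prob_space M for M :: "'a measure" +
  fixes T :: "'a \<Rightarrow> 'a" and J :: "'a measure"
  assumes measurable_T [measurable]: "T \<in> M \<rightarrow>\<^sub>M M"
    and distr_T: "distr M M T = M"
    and space_J: "space J = space M"
    and sets_J: "sets J = {A \<in> sets M. T -` A \<inter> space M = A}"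
begin

lemma subalgebra_J: "subalgebra M J"
  by (auto simp: subalgebra_def space_J sets_J)

sublocale finite_measure_subalgebra M J
  by unfold_locales (rule subalgebra_J)

lemma T_in_space: "x \<in> space M \<Longrightarrow> T x \<in> space M"
  using measurable_T by (rule measurable_space)

lemma invariant_mem_iff: "A \<in> sets J \<Longrightarrow> x \<in> space M \<Longrightarrow> T x \<in> A \<longleftrightarrow> x \<in> A"
  by (auto simp: sets_J)

text \<open>The level set of \<open>h\<close> through \<open>x\<close> belongs to \<open>J\<close>
  and contains \<open>x\<close>, so it contains \<open>T x\<close> as well.\<close>

lemma measurable_J_invariant:
  fixes h :: "'a \<Rightarrow> real"
  assumes "h \<in> borel_measurable J" "x \<in> space M"
  shows "h (T x) = h x"
proof -
  have "h -` {h x} \<inter> space J \<in> sets J"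
    using assms(1) by (rule measurable_sets) simp
  from invariant_mem_iff[OF this assms(2)] show ?thesis
    using assms(2) by (simp add: space_J T_in_space)
qed

lemma integrable_T:
  fixes f :: "'a \<Rightarrow> real"
  shows "integrable M f \<Longrightarrow> integrable M (\<lambda>x. f (T x))"
  using integrable_distr[OF measurable_T, of f] by (simp add: distr_T)

lemma integral_T:
  fixes f :: "'a \<Rightarrow> real"
  assumes "f \<in> borel_measurable M"
  shows "(\<integral>x. f (T x) \<partial>M) = (\<integral>x. f x \<partial>M)"
  using integral_distr[OF measurable_T assms] by (simp add: distr_T)

lemma integrable_max_birkhoff_sum:
  "integrable M g \<Longrightarrow> integrable M (max_birkhoff_sum T g n)"
  by (induction n) (auto intro!: integrable_max intro: integrable_T)

section \<open>The maximal inequality on the set of unbounded orbit sums\<close>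

text \<open>Thresholds are natural numbers so that the set is a countable combination of measurable
  sets; \<open>birkhoff_unbounded_real\<close> recovers arbitrary real thresholds.\<close>

definition birkhoff_unbounded :: "('a \<Rightarrow> real) \<Rightarrow> 'a set" where
  "birkhoff_unbounded g = {x \<in> space M. \<forall>c::nat. \<exists>n. real c < max_birkhoff_sum T g n x}"

lemma birkhoff_unbounded_real:
  assumes "x \<in> birkhoff_unbounded g"
  shows "\<exists>n. c < max_birkhoff_sum T g n x"
proof -
  obtain k :: nat where k: "c < real k"
    using reals_Archimedean2 by blast
  obtain n where "real k < max_birkhoff_sum T g n x"
    using assms by (auto simp: birkhoff_unbounded_def)
  with k show ?thesis
    by (intro exI[of _ n]) simp
qed

text \<open>By the recursion, the maxima at \<open>x\<close> and at \<open>T x\<close> differ, up to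
  an index shift and truncation at 0, only by the fixed number \<open>g x\<close>, so they are
  unbounded together.\<close>

lemma birkhoff_unbounded_in_J:
  assumes "g \<in> borel_measurable M"
  shows "birkhoff_unbounded g \<in> sets J"
proof -
  have [measurable]: "max_birkhoff_sum T g n \<in> borel_measurable M" for n
    using assms by (induction n) simp_all
  have meas: "birkhoff_unbounded g \<in> sets M"
    unfolding birkhoff_unbounded_def by measurable
  have "T x \<in> birkhoff_unbounded g \<longleftrightarrow> x \<in> birkhoff_unbounded g" if x: "x \<in> space M" for x
  proof
    assume Tx: "T x \<in> birkhoff_unbounded g"
    have "\<exists>n. real c < max_birkhoff_sum T g n x" for c
    proof -
      obtain n where "real c - g x < max_birkhoff_sum T g n (T x)"
        using birkhoff_unbounded_real[OF Tx] by blast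
      then have "real c < max_birkhoff_sum T g (Suc n) x"
        by simp
      then show ?thesis ..
    qed
    then show "x \<in> birkhoff_unbounded g"
      using x by (simp add: birkhoff_unbounded_def)
  next
    assume x': "x \<in> birkhoff_unbounded g"
    have "\<exists>n. real c < max_birkhoff_sum T g n (T x)" for c
    proof -
      \<comment> \<open>The extra \<open>\<bar>g x\<bar>\<close> excludes \<open>n = 0\<close>,
        where the maximum is \<open>g x\<close>, and absorbs the summand \<open>g x\<close> of the
        recursion. As \<open>c\<close> is nonnegative, the truncation at 0 then does no
        harm.\<close>
      obtain n where n: "\<bar>g x\<bar> + real c < max_birkhoff_sum T g n x"
        using birkhoff_unbounded_real[OF x'] by blast
      then obtain m where "n = Suc m"
        by (cases n) auto
      with n have "real c < max_birkhoff_sum T g m (T x)"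
        by simp
      then show ?thesis ..
    qed
    then show "T x \<in> birkhoff_unbounded g"
      using x by (simp add: birkhoff_unbounded_def T_in_space)
  qed
  then show ?thesis
    using meas sets.sets_into_space[OF meas] by (auto simp: sets_J)
qed

lemma integral_birkhoff_unbounded_nonneg:
  assumes g: "integrable M g"
  shows "0 \<le> (\<integral>x\<in>birkhoff_unbounded g. g x \<partial>M)"
proof -
  let ?D = "birkhoff_unbounded g" and ?F = "max_birkhoff_sum T g"
  have D: "?D \<in> sets J"
    using g by (intro birkhoff_unbounded_in_J) simp
  then have DM [measurable]: "?D \<in> sets M"
    by (simp add: sets_J)
  have F: "integrable M (?F n)" for n
    using g by (rule integrable_max_birkhoff_sum)
  have [measurable]: "?F n \<in> borel_measurable M" for n
    using F by (rule borel_measurable_integrable)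
  have [measurable]: "g \<in> borel_measurable M"
    using g by simp
  have DF: "integrable M (\<lambda>x. indicator ?D x * ?F n x)" for n
    using integrable_mult_indicator[OF DM F] by simp
  have nonneg: "0 \<le> (\<integral>x. indicator ?D x * (g x - min 0 (?F n (T x))) \<partial>M)" for n
  proof -
    \<comment> \<open>Invariance of the measure moves the integrand to \<open>T x\<close>;
      invariance of \<open>?D\<close> then removes \<open>T\<close> from the indicator.\<close>
    have "(\<integral>x. indicator ?D x * ?F n x \<partial>M) = (\<integral>x. indicator ?D (T x) * ?F n (T x) \<partial>M)"
      by (subst integral_T) simp_all
    also have "\<dots> = (\<integral>x. indicator ?D x * ?F n (T x) \<partial>M)"
      by (intro Bochner_Integration.integral_cong) (auto simp: indicator_def invariant_mem_iff[OF D])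
    finally have shift: "(\<integral>x. indicator ?D x * ?F n x \<partial>M) = (\<integral>x. indicator ?D x * ?F n (T x) \<partial>M)" .
    have DFT: "integrable M (\<lambda>x. indicator ?D x * ?F n (T x))"
      using integrable_mult_indicator[OF DM integrable_T[OF F]] by simp
    have "(\<integral>x. indicator ?D x * ?F n x \<partial>M) \<le> (\<integral>x. indicator ?D x * ?F (Suc n) x \<partial>M)"
      by (intro integral_mono DF mult_left_mono max_birkhoff_sum_Suc_ge) simp
    then have "0 \<le> (\<integral>x. indicator ?D x * ?F (Suc n) x \<partial>M) - (\<integral>x. indicator ?D x * ?F n (T x) \<partial>M)"
      by (simp only: shift)
    also have "\<dots> = (\<integral>x. indicator ?D x * ?F (Suc n) x - indicator ?D x * ?F n (T x) \<partial>M)"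
      by (rule Bochner_Integration.integral_diff[symmetric]) (rule DF DFT)+
    \<comment> \<open>Pointwise this is the recursion together with
      \<open>max 0 y - y = - min 0 y\<close>.\<close>
    also have "\<dots> = (\<integral>x. indicator ?D x * (g x - min 0 (?F n (T x))) \<partial>M)"
      by (intro Bochner_Integration.integral_cong) (auto simp: indicator_def)
    finally show ?thesis .
  qed
  have "(\<lambda>n. \<integral>x. indicator ?D x * (g x - min 0 (?F n (T x))) \<partial>M) \<longlonglongrightarrow> (\<integral>x. indicator ?D x * g x \<partial>M)"
  proof (rule integral_dominated_convergence)
    \<comment> \<open>The maxima start at \<open>g\<close>, so \<open>min 0 (?F n (T x))\<close>
      lies between \<open>- \<bar>g (T x)\<bar>\<close> and 0 for every \<open>n\<close>.\<close>
    show "integrable M (\<lambda>x. \<bar>g x\<bar> + \<bar>g (T x)\<bar>)"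
      using g integrable_T[OF g] by auto
    show "AE x in M. (\<lambda>n. indicator ?D x * (g x - min 0 (?F n (T x)))) \<longlonglongrightarrow> indicator ?D x * g x"
    proof (intro AE_I2)
      fix x assume x: "x \<in> space M"
      show "(\<lambda>n. indicator ?D x * (g x - min 0 (?F n (T x)))) \<longlonglongrightarrow> indicator ?D x * g x"
      proof (cases "x \<in> ?D")
        case True
        then have "T x \<in> ?D"
          using invariant_mem_iff[OF D x] by simp
        \<comment> \<open>Once one maximum at \<open>T x\<close> is positive, monotonicity keeps all
          later ones positive, so the integrand is eventually constant in \<open>n\<close>.\<close>
        then obtain m where m: "0 < ?F m (T x)"
          using birkhoff_unbounded_real by blast
        have "eventually (\<lambda>n. indicator ?D x * (g x - min 0 (?F n (T x))) = indicator ?D x * g x) sequentially"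
          using eventually_ge_at_top[of m]
        proof eventually_elim
          case (elim n)
          then have "0 < ?F n (T x)"
            using max_birkhoff_sum_mono[of m n T g "T x"] m by linarith
          then show ?case
            by simp
        qed
        then show ?thesis
          by (rule tendsto_eventually)
      qed simp
    qed
    show "AE x in M. norm (indicator ?D x * (g x - min 0 (?F n (T x)))) \<le> \<bar>g x\<bar> + \<bar>g (T x)\<bar>" for n
    proof (intro AE_I2)
      fix x
      have "g (T x) \<le> ?F n (T x)"
        using max_birkhoff_sum_mono[of 0 n T g "T x"] by simp
      then show "norm (indicator ?D x * (g x - min 0 (?F n (T x)))) \<le> \<bar>g x\<bar> + \<bar>g (T x)\<bar>"
        by (auto simp: indicator_def)
    qed
  qed measurable
  then have "0 \<le> (\<integral>x. indicator ?D x * g x \<partial>M)"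
    by (rule LIMSEQ_le_const) (use nonneg in blast)
  then show ?thesis
    by (simp add: set_lebesgue_integral_def)
qed

section \<open>Almost sure convergence of Birkhoff averages\<close>

lemma birkhoff_upper:
  assumes f: "integrable M f" and e: "0 < e"
  shows "AE x in M. eventually (\<lambda>n. (\<Sum>i<n. f ((T ^^ i) x)) / real n \<le> real_cond_exp M J f x + e) sequentially"
proof -
  let ?h = "real_cond_exp M J f"
  \<comment> \<open>The slack \<open>e\<close> is halved: one half makes the integral of
    \<open>g\<close> over \<open>D\<close> negative unless \<open>D\<close> is null, the other
    absorbs the remainder \<open>c / n\<close> at the end.\<close>
  define g where "g x = f x - ?h x - e / 2" for x
  define D where "D = birkhoff_unbounded g"
  have h: "integrable M ?h"
    using f by (rule real_cond_exp_int(1))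
  have g: "integrable M g"
    unfolding g_def using f h by simp
  have D: "D \<in> sets J"
    unfolding D_def using g by (intro birkhoff_unbounded_in_J) simp
  then have DM: "D \<in> sets M"
    by (simp add: sets_J)
  have set_int: "set_integrable M D u" if "integrable M u" for u :: "'a \<Rightarrow> real"
    unfolding set_integrable_def using DM that by (rule integrable_mult_indicator)
  have "0 \<le> (\<integral>x\<in>D. g x \<partial>M)"
    unfolding D_def using g by (rule integral_birkhoff_unbounded_nonneg)
  also have "\<dots> = (\<integral>x\<in>D. f x \<partial>M) - (\<integral>x\<in>D. ?h x \<partial>M) - (\<integral>x\<in>D. e / 2 \<partial>M)"
  proof -
    have fh: "set_integrable M D (\<lambda>x. f x - ?h x)" and e2: "set_integrable M D (\<lambda>x. e / 2)"
      using f h by (auto intro!: set_int)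
    show ?thesis
      unfolding g_def set_integral_diff(2)[OF fh e2] set_integral_diff(2)[OF set_int[OF f] set_int[OF h]] ..
  qed
  \<comment> \<open>Since \<open>D\<close> lies in \<open>J\<close>, \<open>f\<close> and its
    conditional expectation have equal integrals over \<open>D\<close> and cancel.\<close>
  also have "\<dots> = - (measure M D * (e / 2))"
    using real_cond_exp_intA[OF f D] DM by (simp add: set_lebesgue_integral_def)
  finally have "measure M D = 0"
    using e measure_nonneg[of M D] by (simp add: zero_le_mult_iff mult_le_0_iff)
  then have "AE x in M. x \<notin> D"
    using DM by (intro AE_not_in) (simp add: null_sets_def emeasure_eq_measure)
  then show ?thesis
    using AE_space
  proof eventually_elim
    case (elim x)
    then have "\<exists>c::nat. \<forall>n. max_birkhoff_sum T g n x \<le> real c"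
      unfolding D_def birkhoff_unbounded_def by (simp add: not_less)
    then obtain c :: nat where c: "\<And>n. max_birkhoff_sum T g n x \<le> real c"
      by blast
    have bound: "(\<Sum>i<Suc n. g ((T ^^ i) x)) \<le> real c" for n
      by (rule order_trans[OF birkhoff_sum_le_max_birkhoff_sum c])
    \<comment> \<open>The conditional expectation is constant along the orbit and can be taken out
      of the orbit sum.\<close>
    have hT: "?h ((T ^^ i) x) = ?h x \<and> (T ^^ i) x \<in> space M" for i
    proof (induction i)
      case (Suc i)
      then have "?h (T ((T ^^ i) x)) = ?h ((T ^^ i) x)"
        by (intro measurable_J_invariant) simp_all
      with Suc show ?case
        by (simp add: T_in_space)
    qed (simp add: elim(2))
    have "(\<lambda>n. real c / real n) \<longlonglongrightarrow> 0"
      by (rule lim_const_over_n)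
    then have "eventually (\<lambda>n. real c / real n < e / 2) sequentially"
      by (rule order_tendstoD(2)) (use e in simp)
    then show ?case
      using eventually_gt_at_top[of 0]
    proof eventually_elim
      case (elim n)
      have "(\<Sum>i<n. g ((T ^^ i) x)) = (\<Sum>i<n. f ((T ^^ i) x) - (?h x + e / 2))"
        unfolding g_def using hT by (intro sum.cong) (simp_all add: algebra_simps)
      also have "\<dots> = (\<Sum>i<n. f ((T ^^ i) x)) - real n * (?h x + e / 2)"
        by (simp only: sum_subtractf sum_constant card_lessThan)
      \<comment> \<open>The bound is indexed by the number of summands minus one, hence the instance
        \<open>n - 1\<close> and the restriction to positive \<open>n\<close>.\<close>
      finally have "(\<Sum>i<n. f ((T ^^ i) x)) \<le> real n * (?h x + e / 2) + real c"
        using bound[of "n - 1"] elim(2) by (simp only: Suc_pred' [symmetric])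
      then have "(\<Sum>i<n. f ((T ^^ i) x)) / real n \<le> (real n * (?h x + e / 2) + real c) / real n"
        by (rule divide_right_mono) simp
      also have "\<dots> = ?h x + e / 2 + real c / real n"
        using elim(2) by (simp add: add_divide_distrib)
      finally show ?case
        using elim(1) by linarith
    qed
  qed
qed

text \<open>The upper bound for \<open>- f\<close> is a lower bound for \<open>f\<close>. Slacks of
  the form \<open>1 / (k + 1)\<close> keep the exceptional sets countable in number.\<close>

theorem birkhoff_ergodic:
  assumes f: "integrable M f"
  shows "AE x in M. (\<lambda>n. (\<Sum>i<n. f ((T ^^ i) x)) / real n) \<longlonglongrightarrow> real_cond_exp M J f x"
proof -
  have "AE x in M. \<forall>k::nat. eventually (\<lambda>n. (\<Sum>i<n. f ((T ^^ i) x)) / real n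
      \<le> real_cond_exp M J f x + inverse (Suc k)) sequentially"
    unfolding AE_all_countable by (intro allI birkhoff_upper f) simp
  moreover have "AE x in M. \<forall>k::nat. eventually (\<lambda>n. (\<Sum>i<n. - f ((T ^^ i) x)) / real n
      \<le> real_cond_exp M J (\<lambda>x. - f x) x + inverse (Suc k)) sequentially"
    unfolding AE_all_countable using f by (intro allI birkhoff_upper[of "\<lambda>x. - f x"]) simp_all
  moreover have "AE x in M. real_cond_exp M J (\<lambda>x. - f x) x = - real_cond_exp M J f x"
    using real_cond_exp_cmult[OF f, of "-1"] by simp
  ultimately show ?thesis
  proof eventually_elim
    case (elim x)
    show ?case
    proof (rule LIMSEQ_I)
      fix r :: real assume "0 < r"
      then obtain k where k: "inverse (real (Suc k)) < r"
        using reals_Archimedean by blast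
      have "eventually (\<lambda>n. norm ((\<Sum>i<n. f ((T ^^ i) x)) / real n - real_cond_exp M J f x) < r) sequentially"
        using elim(1)[rule_format, of k] elim(2)[rule_format, of k]
        by eventually_elim (use k elim(3) in \<open>simp add: sum_negf abs_less_iff\<close>)
      then show "\<exists>no. \<forall>n\<ge>no. norm ((\<Sum>i<n. f ((T ^^ i) x)) / real n - real_cond_exp M J f x) < r"
        by (simp add: eventually_sequentially)
    qed
  qed
qed

end

subsection \<open>Kernels as conditional distributions\<close>

text \<open>Restricted to \<open>A\<close>, the law of \<open>X\<close> and the mixture of the
  kernel are two measures that agree on every set \<open>B\<close> by the defining property of the
  kernel. Hence they integrate every nonnegative function alike.\<close>

lemma (in finite_measure_subalgebra) kernel_set_nn_integral:
  assumes \<kappa>: "\<kappa> \<in> F \<rightarrow>\<^sub>M prob_algebra N" and X [measurable]: "X \<in> M \<rightarrow>\<^sub>M N"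
    and cond: "\<And>B. B \<in> sets N \<Longrightarrow>
      AE x in M. measure (\<kappa> x) B = real_cond_exp M F (indicator (X -` B \<inter> space M)) x"
    and A: "A \<in> sets F" and g: "g \<in> borel_measurable N"
  shows "(\<integral>\<^sup>+x\<in>A. g (X x) \<partial>M) = (\<integral>\<^sup>+x\<in>A. (\<integral>\<^sup>+y. g y \<partial>\<kappa> x) \<partial>M)"
\<comment> \<open>The empty space is treated apart because \<open>bind\<close> over it yields a
  measure on the empty space instead of one on \<open>N\<close>.\<close>
proof (cases "space M = {}")
  case True
  then show ?thesis
    by (simp add: nn_integral_empty)
next
  case False
  have \<kappa>M [measurable]: "\<kappa> \<in> M \<rightarrow>\<^sub>M subprob_algebra N"
    using measurable_from_subalg[OF subalg \<kappa>] by (rule measurable_prob_algebraD)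
  have \<kappa>prob: "prob_space (\<kappa> x)" "sets (\<kappa> x) = sets N" if "x \<in> space M" for x
    using measurable_space[OF \<kappa>, of x] that subalg by (auto simp: space_prob_algebra subalgebra_def)
  have AM [measurable]: "A \<in> sets M"
    using A subalg by (auto simp: subalgebra_def)
  let ?D = "density M (indicator A)"
  have \<kappa>D: "\<kappa> \<in> ?D \<rightarrow>\<^sub>M subprob_algebra N"
    by simp
  have "distr ?D N X = ?D \<bind> \<kappa>"
  proof (rule measure_eqI)
    show "sets (distr ?D N X) = sets (?D \<bind> \<kappa>)"
      using False \<kappa>prob by (subst sets_bind[where N = N]) simp_all
  next
    fix B assume "B \<in> sets (distr ?D N X)"
    then have B [measurable]: "B \<in> sets N"
      by simp
    let ?XB = "X -` B \<inter> space M"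
    have XB [measurable]: "?XB \<in> sets M"
      by measurable
    have int: "integrable M (indicator ?XB :: _ \<Rightarrow> real)"
      using XB by (simp add: emeasure_eq_measure)
    have int': "integrable M (\<lambda>x. indicator A x * real_cond_exp M F (indicator ?XB) x)"
      using integrable_mult_indicator[OF AM real_cond_exp_int(1)[OF int]] by simp
    have "emeasure (?D \<bind> \<kappa>) B = (\<integral>\<^sup>+x. emeasure (\<kappa> x) B \<partial>?D)"
      using False by (intro emeasure_bind[OF _ \<kappa>D B]) simp
    also have "\<dots> = (\<integral>\<^sup>+x. indicator A x * emeasure (\<kappa> x) B \<partial>M)"
      by (rule nn_integral_density)
        (simp_all add: measurable_compose[OF \<kappa>M measurable_emeasure_subprob_algebra[OF B]])
    also have "\<dots> = (\<integral>\<^sup>+x. ennreal (indicator A x * real_cond_exp M F (indicator ?XB) x) \<partial>M)"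
    proof (rule nn_integral_cong_AE)
      show "AE x in M. indicator A x * emeasure (\<kappa> x) B
          = ennreal (indicator A x * real_cond_exp M F (indicator ?XB) x)"
        using cond[OF B] AE_space
      proof eventually_elim
        case (elim x)
        interpret prob_space "\<kappa> x"
          using \<kappa>prob elim(2) by blast
        show ?case
          unfolding elim(1)[symmetric] emeasure_eq_measure by (simp add: indicator_def)
      qed
    qed
    also have "\<dots> = ennreal (\<integral>x. indicator A x * real_cond_exp M F (indicator ?XB) x \<partial>M)"
    proof (rule nn_integral_eq_integral[OF int'])
      show "AE x in M. 0 \<le> indicator A x * real_cond_exp M F (indicator ?XB) x"
        using cond[OF B] by eventually_elim (metis indicator_pos_le measure_nonneg mult_nonneg_nonneg)
    qed
    also have "\<dots> = ennreal (\<integral>x. indicator A x * indicator ?XB x \<partial>M)"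
      using real_cond_exp_intA[OF int A] by (simp add: set_lebesgue_integral_def)
    also have "\<dots> = emeasure M (A \<inter> ?XB)"
      by (simp add: indicator_inter_arith[symmetric] emeasure_eq_measure)
    also have "\<dots> = emeasure ?D ?XB"
      by (simp add: emeasure_density indicator_inter_arith[symmetric])
    also have "\<dots> = emeasure (distr ?D N X) B"
      by (simp add: emeasure_distr)
    finally show "emeasure (distr ?D N X) B = emeasure (?D \<bind> \<kappa>) B" ..
  qed
  then have "(\<integral>\<^sup>+y. g y \<partial>distr ?D N X) = (\<integral>\<^sup>+x. (\<integral>\<^sup>+y. g y \<partial>\<kappa> x) \<partial>?D)"
    using nn_integral_bind[OF g \<kappa>D] by simp
  moreover have "(\<lambda>x. \<integral>\<^sup>+y. g y \<partial>\<kappa> x) \<in> borel_measurable M"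
    by (rule measurable_compose[OF \<kappa>M nn_integral_measurable_subprob_algebra[OF g]])
  ultimately show ?thesis
    using g by (simp add: nn_integral_distr nn_integral_density mult.commute)
qed

text \<open>The kernel integral is \<open>F\<close>-measurable and has the same integrals over sets
  of \<open>F\<close> as \<open>g (X x)\<close>, which characterizes the conditional expectation.
  The comparison starts in the extended nonnegative reals, since finiteness of the kernel integral
  is itself a conclusion.\<close>

lemma (in finite_measure_subalgebra) real_cond_exp_kernel:
  fixes g :: "'b \<Rightarrow> real"
  assumes \<kappa>: "\<kappa> \<in> F \<rightarrow>\<^sub>M prob_algebra N" and X [measurable]: "X \<in> M \<rightarrow>\<^sub>M N"
    and cond: "\<And>B. B \<in> sets N \<Longrightarrow>
      AE x in M. measure (\<kappa> x) B = real_cond_exp M F (indicator (X -` B \<inter> space M)) x"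
    and g [measurable]: "g \<in> borel_measurable N" and nonneg: "\<And>y. 0 \<le> g y"
    and int: "integrable M (\<lambda>x. g (X x))"
  shows "AE x in M. (\<integral>\<^sup>+y. ennreal (g y) \<partial>\<kappa> x) < \<infinity>"
    and "AE x in M. real_cond_exp M F (\<lambda>x. g (X x)) x = (\<integral>y. g y \<partial>\<kappa> x)"
proof -
  define k where "k x = (\<integral>\<^sup>+y. ennreal (g y) \<partial>\<kappa> x)" for x
  have kF [measurable]: "k \<in> borel_measurable F"
    unfolding k_def
    by (rule measurable_compose[OF measurable_prob_algebraD[OF \<kappa>] nn_integral_measurable_subprob_algebra]) simp
  then have kM [measurable]: "k \<in> borel_measurable M"
    by (rule measurable_from_subalg[OF subalg])
  have set_eq: "(\<integral>\<^sup>+x\<in>A. ennreal (g (X x)) \<partial>M) = (\<integral>\<^sup>+x\<in>A. k x \<partial>M)" if "A \<in> sets F" for A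
    unfolding k_def using that by (intro kernel_set_nn_integral[OF \<kappa> X cond]) simp_all
  have FM: "A \<in> sets M" if "A \<in> sets F" for A
    using that subalg by (auto simp: subalgebra_def)
  \<comment> \<open>Taking the whole space for \<open>A\<close> equates the total integrals; a
    function with finite integral is finite almost everywhere.\<close>
  have "space M \<in> sets F"
    using subalg by (metis subalgebra_def sets.top)
  from set_eq[OF this] have total: "(\<integral>\<^sup>+x. ennreal (g (X x)) \<partial>M) = (\<integral>\<^sup>+x. k x \<partial>M)"
    by (simp add: nn_integral_set_ennreal[symmetric] cong: nn_integral_cong)
  have "(\<integral>\<^sup>+x. ennreal (g (X x)) \<partial>M) < \<infinity>"
    using int nonneg by (simp add: integrable_iff_bounded)
  then have fin: "AE x in M. k x < \<infinity>"
    using nn_integral_PInf_AE[OF kM] by (auto simp: total less_top)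
  then show "AE x in M. (\<integral>\<^sup>+y. ennreal (g y) \<partial>\<kappa> x) < \<infinity>"
    by (simp add: k_def)
  have kreal: "AE x in M. ennreal (enn2real (k x)) = k x"
    using fin by eventually_elim simp
  have int_k: "integrable M (\<lambda>x. enn2real (k x))"
  proof (rule integrableI_nonneg)
    show "(\<integral>\<^sup>+x. ennreal (enn2real (k x)) \<partial>M) < \<infinity>"
      using nn_integral_cong_AE[OF kreal] total \<open>_ < \<infinity>\<close> by simp
  qed simp_all
  have "AE x in M. real_cond_exp M F (\<lambda>x. g (X x)) x = enn2real (k x)"
  proof (rule real_cond_exp_charact[OF _ int int_k])
    fix A assume A: "A \<in> sets F"
    have [measurable]: "A \<in> sets M"
      using A by (rule FM)
    have "(\<integral>x\<in>A. g (X x) \<partial>M) = enn2real (\<integral>\<^sup>+x\<in>A. ennreal (g (X x)) \<partial>M)"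
      unfolding set_lebesgue_integral_def using nonneg
      by (subst integral_eq_nn_integral) (auto simp: indicator_def intro!: arg_cong[where f = enn2real] nn_integral_cong)
    also have "\<dots> = enn2real (\<integral>\<^sup>+x\<in>A. ennreal (enn2real (k x)) \<partial>M)"
      unfolding set_eq[OF A]
      by (intro arg_cong[where f = enn2real] nn_integral_cong_AE) (use kreal in eventually_elim, simp)
    also have "\<dots> = (\<integral>x\<in>A. enn2real (k x) \<partial>M)"
      unfolding set_lebesgue_integral_def
      by (subst integral_eq_nn_integral) (auto simp: indicator_def intro!: arg_cong[where f = enn2real] nn_integral_cong)
    finally show "(\<integral>x\<in>A. g (X x) \<partial>M) = (\<integral>x\<in>A. enn2real (k x) \<partial>M)" .
  qed measurable
  then show "AE x in M. real_cond_exp M F (\<lambda>x. g (X x)) x = (\<integral>y. g y \<partial>\<kappa> x)"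
    using AE_space
  proof eventually_elim
    case (elim x)
    have "sets (\<kappa> x) = sets N"
      using measurable_space[OF \<kappa>, of x] elim subalg by (auto simp: space_prob_algebra subalgebra_def)
    then have "g \<in> borel_measurable (\<kappa> x)"
      using g by (simp cong: measurable_cong_sets)
    \<comment> \<open>This holds even where \<open>k x\<close> is infinite: \<open>enn2real\<close>
      and the Bochner integral then both give 0.\<close>
    then show ?case
      using elim(1) nonneg by (simp add: integral_eq_nn_integral k_def)
  qed
qed

subsection \<open>Convergence in the \<open>\<psi>\<close>-weak topology\<close>

lemma sets_empirical_measure: "sets (empirical_measure n \<omega>) = sets borel"
  unfolding empirical_measure_def
  by (metis sets.sigma_sets_eq space_borel sets_measure_of subset_Pow_Union sets.space_closed)

text \<open>As a pushforward of the uniform measure on the indices, the empirical measure inherits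
  the transformation rules for integrals, which turn into finite averages.\<close>

lemma empirical_measure_eq_distr:
  assumes "0 < n"
  shows "empirical_measure n \<omega> = distr (uniform_count_measure {..<n}) borel \<omega>"
proof (rule measure_eqI)
  fix A assume "A \<in> sets (empirical_measure n \<omega>)"
  then have A: "A \<in> sets borel"
    by (simp add: sets_empirical_measure)
  have "emeasure (empirical_measure n \<omega>) A = (\<Sum>i<n. indicator (\<omega> -` A) i) / of_nat n"
    using A by (simp add: emeasure_empirical_measure indicator_vimage)
  also have "\<dots> = of_nat (card ({..<n} \<inter> \<omega> -` A)) / of_nat n"
    by (simp add: indicator_def sum.If_cases vimage_def)
  also have "\<dots> = ennreal (card (\<omega> -` A \<inter> {..<n}) / card {..<n})"
    using assms by (simp add: divide_ennreal[symmetric] ennreal_of_nat_eq_real_of_nat Int_commute)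
  also have "\<dots> = emeasure (distr (uniform_count_measure {..<n}) borel \<omega>) A"
    using A by (subst emeasure_distr)
      (auto simp: space_uniform_count_measure sets_uniform_count_measure emeasure_uniform_count_measure measurable_def)
  finally show "emeasure (empirical_measure n \<omega>) A = emeasure (distr (uniform_count_measure {..<n}) borel \<omega>) A" .
qed (simp add: sets_empirical_measure)

lemma measurable_uniform_count_measure: "\<omega> \<in> uniform_count_measure A \<rightarrow>\<^sub>M borel"
  by (auto simp: measurable_def space_uniform_count_measure sets_uniform_count_measure)

lemma integral_empirical_measure:
  fixes f :: "'a::topological_space \<Rightarrow> real"
  assumes "0 < n" "f \<in> borel_measurable borel"
  shows "(\<integral>x. f x \<partial>empirical_measure n \<omega>) = (\<Sum>i<n. f (\<omega> i)) / real n"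
  using assms
  by (simp add: empirical_measure_eq_distr integral_distr measurable_uniform_count_measure
      integral_uniform_count_measure)

text \<open>For \<open>n = 0\<close> the empirical measure is zero, not a probability measure; later
  statements therefore ask for membership only eventually.\<close>

lemma empirical_measure_in_psi_measures:
  assumes "0 < n" "\<psi> \<in> borel_measurable borel"
  shows "empirical_measure n \<omega> \<in> psi_measures \<psi>"
proof -
  have "prob_space (uniform_count_measure {..<n})"
    using assms(1) by (intro prob_space_uniform_count_measure) auto
  then have "prob_space (empirical_measure n \<omega>)"
    unfolding empirical_measure_eq_distr[OF assms(1)]
    by (rule prob_space.prob_space_distr) (rule measurable_uniform_count_measure)
  moreover have "(\<integral>\<^sup>+x. ennreal (\<psi> x) \<partial>empirical_measure n \<omega>) < \<infinity>"
    using assms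
    by (simp add: empirical_measure_eq_distr nn_integral_distr measurable_uniform_count_measure
        uniform_count_measure_def nn_integral_point_measure_finite ennreal_mult_less_top)
  ultimately show ?thesis
    by (simp add: psi_measures_def sets_empirical_measure)
qed

section \<open>A criterion for \<psi>-weak convergence\<close>

text \<open>Induction on the generation of open sets reduces the claim to subbasic sets. These
  contain only members of \<open>psi_measures \<psi>\<close>, which is where the second assumption
  enters.\<close>

lemma limitin_psi_weak_topologyI:
  assumes "\<nu> \<in> psi_measures \<psi>" "eventually (\<lambda>n. \<mu> n \<in> psi_measures \<psi>) F"
    and "\<And>f. f \<in> psi_functions \<psi> \<Longrightarrow> ((\<lambda>n. \<integral>x. f x \<partial>\<mu> n) \<longlongrightarrow> (\<integral>x. f x \<partial>\<nu>)) F"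
  shows "limitin (psi_weak_topology \<psi>) \<mu> \<nu> F"
  unfolding limitin_def
proof (intro conjI allI impI)
  show "\<nu> \<in> topspace (psi_weak_topology \<psi>)"
    using assms(1) by (simp add: topspace_psi_weak_topology)
  fix U assume "openin (psi_weak_topology \<psi>) U \<and> \<nu> \<in> U"
  then have "generate_topology_on {{\<mu> \<in> psi_measures \<psi>. (\<integral>x. f x \<partial>\<mu>) \<in> U} | f U. f \<in> psi_functions \<psi> \<and> open U} U"
    and "\<nu> \<in> U"
    by (simp_all add: psi_weak_topology_def openin_topology_generated_by_iff)
  then show "eventually (\<lambda>n. \<mu> n \<in> U) F"
  proof (induction rule: generate_topology_on.induct)
    case (Int a b)
    then show ?case
      by (simp add: eventually_conj)
  next
    case (UN K)
    then obtain k where "k \<in> K" "\<nu> \<in> k"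
      by blast
    with UN.IH have "eventually (\<lambda>n. \<mu> n \<in> k) F"
      by blast
    then show ?case
      by eventually_elim (use \<open>k \<in> K\<close> in blast)
  next
    case (Basis s)
    then obtain f V where s: "s = {\<mu> \<in> psi_measures \<psi>. (\<integral>x. f x \<partial>\<mu>) \<in> V}"
      and f: "f \<in> psi_functions \<psi>" and "open V"
      by blast
    with Basis.prems have "eventually (\<lambda>n. (\<integral>x. f x \<partial>\<mu> n) \<in> V) F"
      by (intro topological_tendstoD[OF assms(3)]) simp_all
    with assms(2) show ?case
      by eventually_elim (simp add: s)
  qed simp
qed

section \<open>Approximation of continuous functions from below\<close>

text \<open>The pair \<open>(0, {})\<close> contributes the value 0, so the maximum exists for empty
  \<open>K\<close> too and is nonnegative for every finite \<open>K\<close>.\<close>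

definition max_step :: "(real \<times> 'a set) set \<Rightarrow> 'a \<Rightarrow> real" where
  "max_step K x = Max ((\<lambda>p. fst p * indicator (snd p) x) ` insert (0, {}) K)"

lemma max_step_nonneg: "finite K \<Longrightarrow> 0 \<le> max_step K x"
  unfolding max_step_def by (intro Max_ge) auto

lemma max_step_ge: "finite K \<Longrightarrow> (q, U) \<in> K \<Longrightarrow> x \<in> U \<Longrightarrow> q \<le> max_step K x"
  unfolding max_step_def by (intro Max_ge) (auto intro!: image_eqI[where x = "(q, U)"])

lemma max_step_le:
  "finite K \<Longrightarrow> 0 \<le> c \<Longrightarrow> (\<And>q U. (q, U) \<in> K \<Longrightarrow> x \<in> U \<Longrightarrow> q \<le> c) \<Longrightarrow> max_step K x \<le> c"
  unfolding max_step_def by (subst Max_le_iff) (auto simp: indicator_def)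

lemma borel_measurable_max_step:
  fixes B :: "'a::topological_space set set"
  assumes "topological_basis B" "finite K" "K \<subseteq> S \<times> B"
  shows "max_step K \<in> borel_measurable borel"
proof -
  have "snd p \<in> sets borel" if "p \<in> insert (0, {}) K" for p
    using that assms topological_basis_open[OF assms(1)] by (auto intro!: borel_open)
  then show ?thesis
    unfolding max_step_def using assms(2)
    by (intro borel_measurable_Max) (auto intro!: borel_measurable_times borel_measurable_indicator)
qed

text \<open>If \<open>a < q < f x\<close> with \<open>q\<close> rational, continuity gives a basic
  neighbourhood of \<open>x\<close> on which \<open>f\<close> exceeds \<open>q\<close>. Only
  countably many such pairs lie below \<open>f\<close>, and finite parts of an enumeration of them
  serve as approximants.\<close>

lemma continuous_nonneg_limit_max_step:
  fixes f :: "'a::topological_space \<Rightarrow> real"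
  assumes B: "topological_basis B" "countable B"
    and f: "continuous_on UNIV f" "\<And>x. 0 \<le> f x"
  obtains K where "\<And>k::nat. finite (K k)" "\<And>k. K k \<subseteq> \<rat> \<times> B"
    "\<And>k x. max_step (K k) x \<le> f x" "\<And>x. (\<lambda>k. max_step (K k) x) \<longlonglongrightarrow> f x"
proof -
  define S where "S = {(q, U). q \<in> \<rat> \<and> U \<in> B \<and> (\<forall>x\<in>U. q \<le> f x)}"
  have "S \<subseteq> \<rat> \<times> B"
    by (auto simp: S_def)
  then have countable: "countable S"
    using B(2) countable_rat by (meson countable_SIGMA countable_subset)
  \<comment> \<open>These are the pairs with index at most \<open>k\<close>: finitely many, growing
    with \<open>k\<close> and exhausting \<open>S\<close>.\<close>
  define K where "K k = S \<inter> to_nat_on S -` {..k}" for k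
  have fin: "finite (K k)" for k
    unfolding K_def Int_commute[of S]
    by (intro finite_vimage_IntI inj_on_to_nat_on countable) simp
  have K: "q \<le> f x" if "(q, U) \<in> K k" "x \<in> U" for q U k x
    using that by (auto simp: K_def S_def)
  have le: "max_step (K k) x \<le> f x" for k x
    using fin f(2) by (rule max_step_le) (rule K)
  have "(\<lambda>k. max_step (K k) x) \<longlonglongrightarrow> f x" for x
  proof (rule order_tendstoI)
    fix a assume "f x < a"
    then show "eventually (\<lambda>k. max_step (K k) x < a) sequentially"
      by (auto intro: always_eventually le_less_trans[OF le])
  next
    fix a assume "a < f x"
    then obtain q where q: "q \<in> \<rat>" "a < q" "q < f x"
      using Rats_dense_in_real by blast
    have "open {y. q < f y}"
      using f(1) by (intro open_Collect_less continuous_on_const)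
    then obtain U where U: "U \<in> B" "x \<in> U" "U \<subseteq> {y. q < f y}"
      using topological_basisE[OF B(1)] q(3) by (metis mem_Collect_eq)
    then have S: "(q, U) \<in> S"
      using q(1) by (auto simp: S_def intro: less_imp_le)
    show "eventually (\<lambda>k. a < max_step (K k) x) sequentially"
      using eventually_ge_at_top[of "to_nat_on S (q, U)"]
    proof eventually_elim
      case (elim k)
      then have "(q, U) \<in> K k"
        using S by (simp add: K_def)
      from max_step_ge[OF fin this U(2)] q(2) show ?case
        by simp
    qed
  qed
  with fin le \<open>S \<subseteq> \<rat> \<times> B\<close> show thesis
    by (intro that[of K]) (auto simp: K_def)
qed

lemma integrable_psi_measures:
  fixes f :: "'a::topological_space \<Rightarrow> real"
  assumes "\<mu> \<in> psi_measures \<psi>" "\<psi> \<in> borel_measurable borel" "f \<in> borel_measurable borel"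
    and "\<And>x. \<bar>f x\<bar> \<le> C * \<psi> x" "\<And>x. 0 \<le> \<psi> x"
  shows "integrable \<mu> f"
proof -
  have sets: "sets \<mu> = sets borel" and fin: "(\<integral>\<^sup>+x. ennreal (\<psi> x) \<partial>\<mu>) < \<infinity>"
    using assms(1) by (simp_all add: psi_measures_def)
  have \<psi>: "\<psi> \<in> borel_measurable \<mu>" and f: "f \<in> borel_measurable \<mu>"
    using assms(2,3) sets by (simp_all cong: measurable_cong_sets)
  have "integrable \<mu> \<psi>"
    using \<psi> fin assms(5) by (intro integrableI_nonneg) simp_all
  then have "integrable \<mu> (\<lambda>x. C * \<psi> x)"
    by simp
  then show ?thesis
    using f by (rule Bochner_Integration.integrable_bound) (auto intro!: AE_I2 order_trans[OF assms(4) abs_ge_self])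
qed

section \<open>From step functions to all test functions\<close>

text \<open>Some approximant below \<open>f\<close> already has \<open>\<nu>\<close>-integral above
  \<open>a\<close>. Its integrals converge, so they eventually exceed \<open>a\<close>, and those of
  \<open>f\<close> are at least as large.\<close>

lemma eventually_integral_gt:
  fixes f :: "'a::topological_space \<Rightarrow> real"
  assumes B: "topological_basis B" "countable B"
    and \<psi>: "\<psi> \<in> borel_measurable borel" "\<And>x. 0 \<le> \<psi> x"
    and \<nu>: "\<nu> \<in> psi_measures \<psi>" and \<mu>: "eventually (\<lambda>n. \<mu> n \<in> psi_measures \<psi>) F"
    and conv: "\<And>K. finite K \<Longrightarrow> K \<subseteq> \<rat> \<times> B \<Longrightarrow>
      ((\<lambda>n. \<integral>x. max_step K x \<partial>\<mu> n) \<longlongrightarrow> (\<integral>x. max_step K x \<partial>\<nu>)) F"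
    and f: "continuous_on UNIV f" "\<And>x. 0 \<le> f x" "\<And>x. f x \<le> C * \<psi> x"
    and a: "a < (\<integral>x. f x \<partial>\<nu>)"
  shows "eventually (\<lambda>n. a < (\<integral>x. f x \<partial>\<mu> n)) F"
proof -
  obtain K where K: "\<And>k::nat. finite (K k)" "\<And>k. K k \<subseteq> \<rat> \<times> B"
    "\<And>k x. max_step (K k) x \<le> f x" "\<And>x. (\<lambda>k. max_step (K k) x) \<longlonglongrightarrow> f x"
    using continuous_nonneg_limit_max_step[OF B f(1,2)] by blast
  have fb: "f \<in> borel_measurable borel"
    using f(1) by (rule borel_measurable_continuous_onI)
  have Kb: "max_step (K k) \<in> borel_measurable borel" for k
    using borel_measurable_max_step[OF B(1) K(1,2)] .
  have Kle: "\<bar>max_step (K k) x\<bar> \<le> C * \<psi> x" for k x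
    using max_step_nonneg[OF K(1)] K(3)[of k x] f(3)[of x] by (simp add: abs_of_nonneg)
  have fle: "\<bar>f x\<bar> \<le> C * \<psi> x" for x
    using f(2,3)[of x] by simp
  have int_f: "integrable \<rho> f" and int_K: "integrable \<rho> (max_step (K k))" if "\<rho> \<in> psi_measures \<psi>" for \<rho> k
    using integrable_psi_measures[OF that \<psi>(1) fb fle \<psi>(2)]
      integrable_psi_measures[OF that \<psi>(1) Kb Kle \<psi>(2)] by simp_all
  have "sets \<nu> = sets borel"
    using \<nu> by (simp add: psi_measures_def)
  \<comment> \<open>The approximants lie between 0 and \<open>f\<close>, so \<open>f\<close> itself
    is the dominating function.\<close>
  then have "(\<lambda>k. \<integral>x. max_step (K k) x \<partial>\<nu>) \<longlonglongrightarrow> (\<integral>x. f x \<partial>\<nu>)"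
    using fb Kb K(3,4) max_step_nonneg[OF K(1)]
    by (intro integral_dominated_convergence[where w = f] int_f[OF \<nu>])
      (simp_all cong: measurable_cong_sets)
  then have "eventually (\<lambda>k. a < (\<integral>x. max_step (K k) x \<partial>\<nu>)) sequentially"
    using a by (rule order_tendstoD)
  then obtain k where k: "a < (\<integral>x. max_step (K k) x \<partial>\<nu>)"
    using eventually_happens'[OF sequentially_bot] by blast
  have "eventually (\<lambda>n. a < (\<integral>x. max_step (K k) x \<partial>\<mu> n)) F"
    using conv[OF K(1,2)] k by (rule order_tendstoD)
  with \<mu> show ?thesis
  proof eventually_elim
    case (elim n)
    have "(\<integral>x. max_step (K k) x \<partial>\<mu> n) \<le> (\<integral>x. f x \<partial>\<mu> n)"
      using elim(1) by (intro integral_mono int_f int_K K(3))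
    with elim(2) show ?case
      by simp
  qed
qed

lemma psi_functions_bound:
  assumes "f \<in> psi_functions \<psi>" "\<And>x. 1 \<le> \<psi> x"
  obtains C where "\<And>x. \<bar>f x\<bar> \<le> C * \<psi> x"
proof -
  obtain C where C: "\<And>x. \<bar>f x / \<psi> x\<bar> \<le> C"
    using assms(1) by (auto simp: psi_functions_def bounded_iff)
  have "\<bar>f x\<bar> \<le> C * \<psi> x" for x
  proof -
    have "0 < \<psi> x"
      using assms(2)[of x] by simp
    with C[of x] show ?thesis
      by (simp add: abs_divide pos_divide_le_eq)
  qed
  then show thesis
    by (rule that)
qed

lemma limitin_psi_weak_topology_max_step:
  fixes \<psi> :: "'a::topological_space \<Rightarrow> real"
  assumes B: "topological_basis B" "countable B"
    and \<psi>: "continuous_on UNIV \<psi>" "\<And>x. 1 \<le> \<psi> x"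
    and \<nu>: "\<nu> \<in> psi_measures \<psi>" and \<mu>: "eventually (\<lambda>n. \<mu> n \<in> psi_measures \<psi>) F"
    and conv: "\<And>K. finite K \<Longrightarrow> K \<subseteq> \<rat> \<times> B \<Longrightarrow>
      ((\<lambda>n. \<integral>x. max_step K x \<partial>\<mu> n) \<longlongrightarrow> (\<integral>x. max_step K x \<partial>\<nu>)) F"
    and conv_\<psi>: "((\<lambda>n. \<integral>x. \<psi> x \<partial>\<mu> n) \<longlongrightarrow> (\<integral>x. \<psi> x \<partial>\<nu>)) F"
  shows "limitin (psi_weak_topology \<psi>) \<mu> \<nu> F"
proof (rule limitin_psi_weak_topologyI[OF \<nu> \<mu>])
  fix f assume f: "f \<in> psi_functions \<psi>"
  then have f_cont: "continuous_on UNIV f"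
    by (simp add: psi_functions_def)
  obtain C where C: "\<And>x. \<bar>f x\<bar> \<le> C * \<psi> x"
    using psi_functions_bound[OF f \<psi>(2)] by blast
  have \<psi>0: "0 \<le> \<psi> x" for x
    using \<psi>(2)[of x] by simp
  have \<psi>b: "\<psi> \<in> borel_measurable borel" and fb: "f \<in> borel_measurable borel"
    using \<psi>(1) f_cont by (simp_all add: borel_measurable_continuous_onI)
  have int_\<psi>: "integrable \<rho> \<psi>" and int_f: "integrable \<rho> f" if "\<rho> \<in> psi_measures \<psi>" for \<rho>
    using integrable_psi_measures[OF that \<psi>b \<psi>b, of 1] integrable_psi_measures[OF that \<psi>b fb C]
    by (simp_all add: \<psi>0)
  \<comment> \<open>The sign \<open>s\<close> treats \<open>C * \<psi> + f\<close> and
    \<open>C * \<psi> - f\<close> at once; both lie between 0 and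
    \<open>2 * C * \<psi>\<close>.\<close>
  have lower: "eventually (\<lambda>n. a < (\<integral>x. C * \<psi> x + s * f x \<partial>\<mu> n)) F"
    if "\<bar>s\<bar> = 1" and a: "a < (\<integral>x. C * \<psi> x + s * f x \<partial>\<nu>)" for s a
  proof (rule eventually_integral_gt[OF B \<psi>b \<psi>0 \<nu> \<mu> conv _ _ _ a])
    have "s = 1 \<or> s = -1"
      using that(1) by auto
    then have "\<bar>s * f x\<bar> = \<bar>f x\<bar>" for x
      by auto
    then have *: "\<bar>s * f x\<bar> \<le> C * \<psi> x" for x
      using C by simp
    show "0 \<le> C * \<psi> x + s * f x" "C * \<psi> x + s * f x \<le> (2 * C) * \<psi> x" for x
      using *[of x] by auto
    show "continuous_on UNIV (\<lambda>x. C * \<psi> x + s * f x)"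
      using \<psi>(1) f_cont by (intro continuous_intros)
  qed
  have split: "(\<integral>x. C * \<psi> x + s * f x \<partial>\<rho>) = C * (\<integral>x. \<psi> x \<partial>\<rho>) + s * (\<integral>x. f x \<partial>\<rho>)"
    if "\<rho> \<in> psi_measures \<psi>" for s \<rho>
    using int_\<psi>[OF that] int_f[OF that] by simp
  have conv_C: "((\<lambda>n. C * (\<integral>x. \<psi> x \<partial>\<mu> n)) \<longlongrightarrow> C * (\<integral>x. \<psi> x \<partial>\<nu>)) F"
    using conv_\<psi> by (rule tendsto_mult_left)
  have gt: "eventually (\<lambda>n. s * (\<integral>x. f x \<partial>\<nu>) - e < s * (\<integral>x. f x \<partial>\<mu> n)) F" if "\<bar>s\<bar> = 1" "0 < e" for s e
  proof -
    \<comment> \<open>One half of \<open>e\<close> is spent on the lower bound for the sum, the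
      other on removing the convergent part \<open>C * \<psi>\<close>.\<close>
    have "eventually (\<lambda>n. C * (\<integral>x. \<psi> x \<partial>\<nu>) + s * (\<integral>x. f x \<partial>\<nu>) - e / 2
        < (\<integral>x. C * \<psi> x + s * f x \<partial>\<mu> n)) F"
      using that by (intro lower) (simp_all add: split[OF \<nu>])
    moreover have "eventually (\<lambda>n. C * (\<integral>x. \<psi> x \<partial>\<mu> n) < C * (\<integral>x. \<psi> x \<partial>\<nu>) + e / 2) F"
      using that by (intro order_tendstoD[OF conv_C]) simp
    ultimately show ?thesis
      using \<mu>
    proof eventually_elim
      case (elim n)
      then show ?case
        unfolding split[OF elim(3)] by linarith
    qed
  qed
  show "((\<lambda>n. \<integral>x. f x \<partial>\<mu> n) \<longlongrightarrow> (\<integral>x. f x \<partial>\<nu>)) F"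
  proof (rule tendstoI)
    fix e :: real assume "0 < e"
    then have "eventually (\<lambda>n. 1 * (\<integral>x. f x \<partial>\<nu>) - e < 1 * (\<integral>x. f x \<partial>\<mu> n)) F"
      "eventually (\<lambda>n. -1 * (\<integral>x. f x \<partial>\<nu>) - e < -1 * (\<integral>x. f x \<partial>\<mu> n)) F"
      by (intro gt; simp)+
    then show "eventually (\<lambda>n. dist (\<integral>x. f x \<partial>\<mu> n) (\<integral>x. f x \<partial>\<nu>) < e) F"
      by eventually_elim (simp add: dist_real_def abs_less_iff)
  qed
qed

subsection \<open>Stationary sequences\<close>

lemma measurable_path_shift: "path_shift \<in> path_space \<rightarrow>\<^sub>M path_space"
  unfolding path_shift_def
  by (rule measurable_PiM_single') (auto simp: space_PiM intro: measurable_component_singleton)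

lemma funpow_path_shift: "(path_shift ^^ i) \<omega> j = \<omega> (i + j)"
  by (induction i arbitrary: j) (simp_all add: path_shift_def)

text \<open>As \<open>P\<close> carries the sets of the path space, the law of the identity is
  \<open>P\<close> itself, so stationarity says that the shift preserves \<open>P\<close>.\<close>

lemma stationary_measure_preserving_system:
  assumes "prob_space P" "sets P = sets path_space" "stationary P"
  shows "measure_preserving_system P path_shift invariant_algebra"
proof -
  have space: "space P = UNIV"
    using sets_eq_imp_space_eq[OF assms(2)] by (simp add: space_PiM)
  have T: "path_shift \<in> P \<rightarrow>\<^sub>M P"
    using measurable_path_shift by (simp add: measurable_cong_sets[OF assms(2,2)])
  have "distr P P path_shift = distr P path_space path_shift"
    using assms(2) by (intro distr_cong) simp_all
  also have "\<dots> = distr P path_space (\<lambda>\<omega>. \<omega>)"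
    using assms(3) by (simp add: stationary_def)
  also have "\<dots> = distr P P (\<lambda>\<omega>. \<omega>)"
    using assms(2) by (intro distr_cong) simp_all
  also have "\<dots> = P"
    by simp
  finally have "distr P P path_shift = P" .
  moreover have "space invariant_algebra = (UNIV :: (nat \<Rightarrow> 'a) set)"
    by (simp add: invariant_algebra_def space_measure_of_conv)
  ultimately show ?thesis
    using assms(1,2) T space
    by (intro measure_preserving_system.intro measure_preserving_system_axioms.intro)
      (simp_all add: sets_invariant_algebra)
qed

theorem theorem1:
  fixes P :: "(nat \<Rightarrow> 'a::polish_space) measure"
    and \<psi> :: "'a \<Rightarrow> real"
    and \<upsilon> :: "(nat \<Rightarrow> 'a) \<Rightarrow> 'a measure"
  assumes "continuous_on UNIV \<psi>"
    and "\<And>x. 1 \<le> \<psi> x"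
    and "prob_space P"
    and "sets P = sets path_space"
    and "canonical_random_measure P \<upsilon>"
    and "stationary P"
    and "distr P borel (\<lambda>\<omega>. \<omega> 0) \<in> psi_measures \<psi>"
  shows "AE \<omega> in completion P.
    limitin (psi_weak_topology \<psi>) (\<lambda>n. empirical_measure n \<omega>) (\<upsilon> \<omega>) sequentially"
proof -
  interpret measure_preserving_system P path_shift invariant_algebra
    using assms(3,4,6) by (rule stationary_measure_preserving_system)
  have space: "space P = UNIV"
    using sets_eq_imp_space_eq[OF assms(4)] by (simp add: space_PiM)
  have X: "(\<lambda>\<omega>. \<omega> 0) \<in> P \<rightarrow>\<^sub>M borel"
    unfolding measurable_cong_sets[OF assms(4) refl] by (rule measurable_component_singleton) simp
  have \<upsilon>: "\<upsilon> \<in> invariant_algebra \<rightarrow>\<^sub>M prob_algebra borel"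
    and cond: "AE \<omega> in P. measure (\<upsilon> \<omega>) B
      = real_cond_exp P invariant_algebra (indicator ((\<lambda>\<omega>. \<omega> 0) -` B \<inter> space P)) \<omega>"
    if "B \<in> sets borel" for B
    using assms(5) that by (simp_all add: canonical_random_measure_def space vimage_def)
  \<comment> \<open>The joint statement attached the premise on \<open>B\<close> to the
    measurability of \<open>\<upsilon>\<close> as well; the empty set discharges it.\<close>
  note \<upsilon> = \<upsilon>[OF sets.empty_sets]
  have \<psi>b: "\<psi> \<in> borel_measurable borel"
    using assms(1) by (rule borel_measurable_continuous_onI)
  have \<psi>0: "0 \<le> \<psi> x" for x
    using assms(2)[of x] by simp
  have \<psi>C: "\<bar>\<psi> x\<bar> \<le> 1 * \<psi> x" for x
    using \<psi>0[of x] by simp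
  have law: "integrable P (\<lambda>\<omega>. g (\<omega> 0))"
    if "g \<in> borel_measurable borel" "\<And>x. \<bar>g x\<bar> \<le> C * \<psi> x" for g :: "'a \<Rightarrow> real" and C
    using integrable_psi_measures[OF assms(7) \<psi>b that \<psi>0] X that(1) by (simp add: integrable_distr_eq)
  have kernel_fin: "AE \<omega> in P. (\<integral>\<^sup>+x. ennreal (g x) \<partial>\<upsilon> \<omega>) < \<infinity>"
    and kernel_eq: "AE \<omega> in P. real_cond_exp P invariant_algebra (\<lambda>\<omega>. g (\<omega> 0)) \<omega> = (\<integral>x. g x \<partial>\<upsilon> \<omega>)"
    if "g \<in> borel_measurable borel" "\<And>x. 0 \<le> g x" "\<And>x. \<bar>g x\<bar> \<le> C * \<psi> x" for g :: "'a \<Rightarrow> real" and C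
    using real_cond_exp_kernel[OF \<upsilon> X _ that(1,2) law[OF that(1,3)]] cond by blast+
  have avg: "AE \<omega> in P. (\<lambda>n. \<integral>x. g x \<partial>empirical_measure n \<omega>) \<longlonglongrightarrow> (\<integral>x. g x \<partial>\<upsilon> \<omega>)"
    if g: "g \<in> borel_measurable borel" and g0: "\<And>x. 0 \<le> g x" and gC: "\<And>x. \<bar>g x\<bar> \<le> C * \<psi> x"
    for g :: "'a \<Rightarrow> real" and C
    \<comment> \<open>The Birkhoff averages of \<open>\<lambda>\<omega>. g (\<omega> 0)\<close>
      under the shift are the empirical averages of \<open>g\<close>; their limit, a conditional
      expectation, is the \<open>\<upsilon>\<close>-integral of \<open>g\<close>.\<close>
    using birkhoff_ergodic[OF law[OF g gC]] kernel_eq[OF g g0 gC]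
  proof eventually_elim
    case (elim \<omega>)
    have "eventually (\<lambda>n. (\<Sum>i<n. g (\<omega> i)) / real n = (\<integral>x. g x \<partial>empirical_measure n \<omega>)) sequentially"
      using eventually_gt_at_top[of 0] by eventually_elim (simp add: integral_empirical_measure g)
    with elim show ?case
      by (simp add: funpow_path_shift filterlim_cong)
  qed
  have \<upsilon>\<psi>: "AE \<omega> in P. \<upsilon> \<omega> \<in> psi_measures \<psi>"
    using kernel_fin[OF \<psi>b \<psi>0 \<psi>C] AE_space
  proof eventually_elim
    case (elim \<omega>)
    have "\<upsilon> \<omega> \<in> space (prob_algebra borel)"
      by (rule measurable_space[OF \<upsilon>]) (simp add: space_J space)
    with elim show ?case
      by (simp add: psi_measures_def space_prob_algebra)
  qed
  obtain B :: "'a set set" where B: "topological_basis B" "countable B"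
    using ex_countable_basis by blast
  \<comment> \<open>Countability of the test family is what yields a single null set for all its
    members.\<close>
  have "countable {K. finite K \<and> K \<subseteq> \<rat> \<times> B}"
    using B(2) countable_rat by (intro countable_Collect_finite_subset countable_SIGMA)
  moreover have "AE \<omega> in P. (\<lambda>n. \<integral>x. max_step K x \<partial>empirical_measure n \<omega>) \<longlonglongrightarrow> (\<integral>x. max_step K x \<partial>\<upsilon> \<omega>)"
    if K: "K \<in> {K. finite K \<and> K \<subseteq> \<rat> \<times> B}" for K
  proof (rule avg)
    have fin: "finite K"
      using K by simp
    show "max_step K \<in> borel_measurable borel"
      using K by (intro borel_measurable_max_step[OF B(1)]) auto
    show "0 \<le> max_step K x" for x
      using fin by (rule max_step_nonneg)
    \<comment> \<open>A crude constant above every coefficient; \<open>1 \<le> \<psi> x\<close>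
      turns the constant bound into a multiple of \<open>\<psi>\<close>.\<close>
    define C where "C = (\<Sum>p\<in>K. \<bar>fst p\<bar>)"
    have C: "\<bar>q\<bar> \<le> C" if "(q, U) \<in> K" for q U
      unfolding C_def using member_le_sum[OF that, of "\<lambda>p. \<bar>fst p\<bar>"] fin by simp
    have "0 \<le> C"
      unfolding C_def by (intro sum_nonneg) simp
    show "\<bar>max_step K x\<bar> \<le> C * \<psi> x" for x
    proof -
      have "max_step K x \<le> C"
        using fin \<open>0 \<le> C\<close> by (rule max_step_le) (use C in \<open>fastforce simp: abs_le_iff\<close>)
      also have "\<dots> \<le> C * \<psi> x"
        using mult_left_mono[OF assms(2)[of x] \<open>0 \<le> C\<close>] by simp
      finally show ?thesis
        using max_step_nonneg[OF fin, of x] by simp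
    qed
  qed
  ultimately have "AE \<omega> in P. \<forall>K\<in>{K. finite K \<and> K \<subseteq> \<rat> \<times> B}.
      (\<lambda>n. \<integral>x. max_step K x \<partial>empirical_measure n \<omega>) \<longlonglongrightarrow> (\<integral>x. max_step K x \<partial>\<upsilon> \<omega>)"
    by (subst AE_ball_countable) blast+
  moreover have "AE \<omega> in P. (\<lambda>n. \<integral>x. \<psi> x \<partial>empirical_measure n \<omega>) \<longlonglongrightarrow> (\<integral>x. \<psi> x \<partial>\<upsilon> \<omega>)"
    using \<psi>b \<psi>0 \<psi>C by (rule avg)
  ultimately have "AE \<omega> in P.
    limitin (psi_weak_topology \<psi>) (\<lambda>n. empirical_measure n \<omega>) (\<upsilon> \<omega>) sequentially"
    using \<upsilon>\<psi>
  proof eventually_elim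
    case (elim \<omega>)
    have "eventually (\<lambda>n. empirical_measure n \<omega> \<in> psi_measures \<psi>) sequentially"
      using eventually_gt_at_top[of 0] by eventually_elim (rule empirical_measure_in_psi_measures[OF _ \<psi>b])
    with elim show ?case
      by (intro limitin_psi_weak_topology_max_step[OF B assms(1,2)]) auto
  qed
  \<comment> \<open>The exceptional set is null for \<open>P\<close> itself, and such sets remain
    null in the completion.\<close>
  then show ?thesis
    by (rule AE_completion)
qed

end
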